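(* Let $G=(V,E,O,Pr)$ be a parity game and $J^0$ a safe justification for $G$ (for instance $J^0=(V,\emptyset,H_d)$). Consider any sequence $J^0,J^1,J^2,\dots$ in which each $J^{i+1}=\mathrm{Justify}(J^i,v_i,dj_i)$ for some node $v_i$ and direct justification $dj_i$ such that this operation is executable, and which is continued as long as $J^i$ has an unjustified node. Then every such sequence is finite and ends in a safe justification $J^k=(V,D^k,H^k)$ without unjustified nodes; $H^k$ is the winning function of $G$, and $\sigma_{J^k,0}$, $\sigma_{J^k,1}$ are winning strategies for players $0$ and $1$ on the nodes they win.
   Context: A parity game is $G=(V,E,O,Pr)$ with finite node set $V$, moves $E\subseteq V\times V$ (every node has an outgoing edge), owner $O:V\to\{0,1\}$ and priority $Pr:V\to\mathbb{N}$; $\bar\alpha=1-\alpha$, $O_\alpha=\{v\mid O(v)=\alpha\}$. A play of $G$ is an infinite path along $E$, won by player $(m\bmod 2)$ where $m$ is the highest priority occurring infinitely often. A strategy for $\alpha$ is a partial function $\sigma$ from a subset of $O_\alpha$ to $V$; a play is consistent with $\sigma$ if $v_{i+1}=\sigma(v_i)$ whenever $v_i\in dom(\sigma)$. The winning function $W:V\to\{0,1\}$ of $G$ maps each node to the player who has a strategy winning all plays from it consistent with that strategy; a winning strategy for $\alpha$ on the nodes it wins is one such that every play starting in a node $v$ with $W(v)=\alpha$ consistent with it is won by $\alpha$. A direct justification for $\alpha$ to win $v$: one outgoing edge of $v$ if $O(v)=\alpha$, all outgoing edges of $v$ if $O(v)=\bar\alpha$; it wins $v$ for $\alpha$ under $H:V\to\{0,1\}$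 if $H(w)=\alpha$ for all its edges $(v,w)$. A justification is $J=(V,D,H)$ with $D\subseteq E$, $H:V\to\{0,1\}$; $v$ is justified if it has outgoing edges in $D$, unjustified otherwise. $J$ is weakly winning if each justified node's set of outgoing $D$-edges is a direct justification winning it for $H(v)$ under $H$; $J$ is winning if moreover every infinite path $v_1,v_2,\dots$ in $(V,D)$ is won by $H(v_1)$. For a justification $J$, $\sigma_{J,\alpha}=\{(v,w)\in D\mid O(v)=H(v)=\alpha\}$. Let $\downarrow v$ be the set of nodes from which $v$ is reachable in $(V,D)$ (including $v$). The justification level $jl_J(v)$ is the minimum priority of unjustified nodes reachable from $v$ in $(V,D)$ (including $v$), or $+\infty$ if none; for $dj=\{(v,w_1),\dots,(v,w_k)\}$, $jl_J(dj)=\min_i jl_J(w_i)$. The default hypothesis is $H_d(v)=Pr(v)\bmod 2$. $J$ is safe if (i) $J$ is winning, (ii) $H(v)=H_d(v)$ for all unjustified $v$, (iii) $jl_J(v)\ge Pr(v)$ for all $v$. $J[v:dj,\alpha]$ replaces the outgoing $D$-edges of $v$ by $dj$ and sets $H(v):=\alpha$; $J[w:\emptyset,H_d(w)\mid w\in S]$ removes all outgoing $D$-edges of each $w\in S$ and sets $H(w):=H_d(w)$; modifications apply left to right. $\mathrm{Justify}(J,v,dj)$ is executable if: (1) $J$ is safe and there is a player $\alpha$ such that $dj$ is a direct justification winning $v$ for $\alpha$ under $H$; (2) if $v$ is unjustified then $jl_J(dj)\ge jl_J(v)$, if $v$ is justified then $jl_J(dj)>jl_J(v)$. Then $\mathrm{Justify}(J,v,dj)=J[v:dj,\alpha]$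 if $H(v)=\alpha$, and $=J[w:\emptyset,H_d(w)\mid w\in\downarrow v][v:dj,\alpha]$ if $H(v)=\bar\alpha$.
   Formalization: Strategies are required to choose moves in E; with arbitrary partial functions into V, a strategy prescribing a non-edge has no consistent plays and wins vacuously, so the winning function would not be well defined. *)

theory Defs
  imports Main "HOL-Library.Extended_Nat"
begin

text \<open>Players are the natural numbers 0 and 1. Owner, priority and hypothesis functions are total
  in the logic; only their values on the node set matter.\<close>

record 'v parity_game =
  nodes :: "'v set"
  moves :: "('v \<times> 'v) set"
  owner :: "'v \<Rightarrow> nat"
  prio  :: "'v \<Rightarrow> nat"

definition parity_game :: "'v parity_game \<Rightarrow> bool" where
  "parity_game G \<longleftrightarrow>
     finite (nodes G) \<and>
     moves G \<subseteq> nodes G \<times> nodes G \<and>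
     (\<forall>v\<in>nodes G. \<exists>w. (v, w) \<in> moves G) \<and>
     (\<forall>v\<in>nodes G. owner G v \<in> {0, 1})"

definition infinite_path :: "('v \<times> 'v) set \<Rightarrow> (nat \<Rightarrow> 'v) \<Rightarrow> bool" where
  "infinite_path R p \<longleftrightarrow> (\<forall>i. (p i, p (Suc i)) \<in> R)"

definition play :: "'v parity_game \<Rightarrow> (nat \<Rightarrow> 'v) \<Rightarrow> bool" where
  "play G p \<longleftrightarrow> infinite_path (moves G) p"

definition play_winner :: "'v parity_game \<Rightarrow> (nat \<Rightarrow> 'v) \<Rightarrow> nat" where
  "play_winner G p = Max {m. infinite {i. prio G (p i) = m}} mod 2"

text \<open>Partial functions are single-valued relations. Strategies choose moves of the game:
  otherwise a strategy prescribing a non-edge would admit no consistent play and win vacuously.\<close>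

definition strategy :: "'v parity_game \<Rightarrow> nat \<Rightarrow> ('v \<times> 'v) set \<Rightarrow> bool" where
  "strategy G \<alpha> \<sigma> \<longleftrightarrow>
     single_valued \<sigma> \<and> \<sigma> \<subseteq> moves G \<and> Domain \<sigma> \<subseteq> {v \<in> nodes G. owner G v = \<alpha>}"

definition consistent :: "('v \<times> 'v) set \<Rightarrow> (nat \<Rightarrow> 'v) \<Rightarrow> bool" where
  "consistent \<sigma> p \<longleftrightarrow> (\<forall>i. p i \<in> Domain \<sigma> \<longrightarrow> (p i, p (Suc i)) \<in> \<sigma>)"

definition wins_from :: "'v parity_game \<Rightarrow> nat \<Rightarrow> ('v \<times> 'v) set \<Rightarrow> 'v \<Rightarrow> bool" where
  "wins_from G \<alpha> \<sigma> v \<longleftrightarrow>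
     (\<forall>p. play G p \<and> p 0 = v \<and> consistent \<sigma> p \<longrightarrow> play_winner G p = \<alpha>)"

definition wins :: "'v parity_game \<Rightarrow> nat \<Rightarrow> 'v \<Rightarrow> bool" where
  "wins G \<alpha> v \<longleftrightarrow> (\<exists>\<sigma>. strategy G \<alpha> \<sigma> \<and> wins_from G \<alpha> \<sigma> v)"

text \<open>The equivalence expresses that \<open>W v\<close> is the unique player with such a strategy.\<close>

definition winning_function :: "'v parity_game \<Rightarrow> ('v \<Rightarrow> nat) \<Rightarrow> bool" where
  "winning_function G W \<longleftrightarrow>
     (\<forall>v\<in>nodes G. W v \<in> {0, 1} \<and> (\<forall>\<alpha>\<in>{0, 1}. wins G \<alpha> v \<longleftrightarrow> W v = \<alpha>))"

definition winning_strategy :: "'v parity_game \<Rightarrow> nat \<Rightarrow> ('v \<times> 'v) set \<Rightarrow> bool" where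
  "winning_strategy G \<alpha> \<sigma> \<longleftrightarrow>
     strategy G \<alpha> \<sigma> \<and> (\<forall>v\<in>nodes G. wins G \<alpha> v \<longrightarrow> wins_from G \<alpha> \<sigma> v)"


definition direct_justification ::
    "'v parity_game \<Rightarrow> nat \<Rightarrow> 'v \<Rightarrow> ('v \<times> 'v) set \<Rightarrow> bool" where
  "direct_justification G \<alpha> v dj \<longleftrightarrow>
     v \<in> nodes G \<and> \<alpha> \<in> {0, 1} \<and>
     (if owner G v = \<alpha> then \<exists>w. (v, w) \<in> moves G \<and> dj = {(v, w)}
      else dj = {e \<in> moves G. fst e = v})"

definition winning_dj ::
    "'v parity_game \<Rightarrow> ('v \<Rightarrow> nat) \<Rightarrow> nat \<Rightarrow> 'v \<Rightarrow> ('v \<times> 'v) set \<Rightarrow> bool" where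
  "winning_dj G H \<alpha> v dj \<longleftrightarrow> direct_justification G \<alpha> v dj \<and> (\<forall>(u, w)\<in>dj. H w = \<alpha>)"

text \<open>The node set of a justification is that of the game and is not stored.\<close>

record 'v justification =
  edges :: "('v \<times> 'v) set"
  hyp :: "'v \<Rightarrow> nat"

definition is_justification :: "'v parity_game \<Rightarrow> 'v justification \<Rightarrow> bool" where
  "is_justification G J \<longleftrightarrow> edges J \<subseteq> moves G \<and> (\<forall>v\<in>nodes G. hyp J v \<in> {0, 1})"

definition out_edges :: "'v justification \<Rightarrow> 'v \<Rightarrow> ('v \<times> 'v) set" where
  "out_edges J v = {e \<in> edges J. fst e = v}"

definition justified :: "'v parity_game \<Rightarrow> 'v justification \<Rightarrow> 'v set" where
  "justified G J = {v \<in> nodes G. out_edges J v \<noteq> {}}"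

definition unjustified :: "'v parity_game \<Rightarrow> 'v justification \<Rightarrow> 'v set" where
  "unjustified G J = {v \<in> nodes G. out_edges J v = {}}"

definition weakly_winning :: "'v parity_game \<Rightarrow> 'v justification \<Rightarrow> bool" where
  "weakly_winning G J \<longleftrightarrow>
     is_justification G J \<and>
     (\<forall>v\<in>justified G J. winning_dj G (hyp J) (hyp J v) v (out_edges J v))"

definition winning :: "'v parity_game \<Rightarrow> 'v justification \<Rightarrow> bool" where
  "winning G J \<longleftrightarrow>
     weakly_winning G J \<and>
     (\<forall>p. infinite_path (edges J) p \<longrightarrow> play_winner G p = hyp J (p 0))"

definition justification_strategy ::
    "'v parity_game \<Rightarrow> 'v justification \<Rightarrow> nat \<Rightarrow> ('v \<times> 'v) set" where
  "justification_strategy G J \<alpha> = {(v, w) \<in> edges J. owner G v = \<alpha> \<and> hyp J v = \<alpha>}"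

definition down :: "'v parity_game \<Rightarrow> 'v justification \<Rightarrow> 'v \<Rightarrow> 'v set" where
  "down G J v = {u \<in> nodes G. (u, v) \<in> (edges J)\<^sup>*}"

text \<open>The infimum of the empty set in \<^typ>\<open>enat\<close> is \<open>\<infinity>\<close>.\<close>

definition jl :: "'v parity_game \<Rightarrow> 'v justification \<Rightarrow> 'v \<Rightarrow> enat" where
  "jl G J v = (INF w\<in>{w \<in> unjustified G J. (v, w) \<in> (edges J)\<^sup>*}. enat (prio G w))"

definition jl_dj :: "'v parity_game \<Rightarrow> 'v justification \<Rightarrow> ('v \<times> 'v) set \<Rightarrow> enat" where
  "jl_dj G J dj = (INF e\<in>dj. jl G J (snd e))"

definition default_hyp :: "'v parity_game \<Rightarrow> 'v \<Rightarrow> nat" where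
  "default_hyp G v = prio G v mod 2"

definition safe :: "'v parity_game \<Rightarrow> 'v justification \<Rightarrow> bool" where
  "safe G J \<longleftrightarrow>
     winning G J \<and>
     (\<forall>v\<in>unjustified G J. hyp J v = default_hyp G v) \<and>
     (\<forall>v\<in>nodes G. jl G J v \<ge> enat (prio G v))"

definition set_dj ::
    "'v justification \<Rightarrow> 'v \<Rightarrow> ('v \<times> 'v) set \<Rightarrow> nat \<Rightarrow> 'v justification" where
  "set_dj J v dj \<alpha> =
     \<lparr>edges = {e \<in> edges J. fst e \<noteq> v} \<union> dj, hyp = (hyp J)(v := \<alpha>)\<rparr>"

definition reset :: "'v parity_game \<Rightarrow> 'v justification \<Rightarrow> 'v set \<Rightarrow> 'v justification" where
  "reset G J S =
     \<lparr>edges = {e \<in> edges J. fst e \<notin> S},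
      hyp = (\<lambda>w. if w \<in> S then default_hyp G w else hyp J w)\<rparr>"

definition executable ::
    "'v parity_game \<Rightarrow> 'v justification \<Rightarrow> 'v \<Rightarrow> ('v \<times> 'v) set \<Rightarrow> bool" where
  "executable G J v dj \<longleftrightarrow>
     safe G J \<and>
     (\<exists>\<alpha>\<in>{0, 1}. winning_dj G (hyp J) \<alpha> v dj) \<and>
     (v \<in> unjustified G J \<longrightarrow> jl_dj G J dj \<ge> jl G J v) \<and>
     (v \<in> justified G J \<longrightarrow> jl_dj G J dj > jl G J v)"

text \<open>The player is determined by \<open>dj\<close>, because a direct justification is nonempty
  and its edges lead to nodes with hypothesis \<open>\<alpha>\<close>.\<close>

lemma winning_dj_unique:
  assumes "parity_game G" "winning_dj G H \<alpha> v dj" "winning_dj G H \<beta> v dj"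
  shows "\<alpha> = \<beta>"
proof -
  have "dj \<noteq> {}"
    using assms(1,2)
    by (fastforce simp: parity_game_def winning_dj_def direct_justification_def split: if_splits)
  then show ?thesis
    using assms(2,3) by (fastforce simp: winning_dj_def)
qed

definition Justify ::
    "'v parity_game \<Rightarrow> 'v justification \<Rightarrow> 'v \<Rightarrow> ('v \<times> 'v) set \<Rightarrow> 'v justification" where
  "Justify G J v dj =
     (let \<alpha> = (THE \<alpha>. winning_dj G (hyp J) \<alpha> v dj)
      in if hyp J v = \<alpha> then set_dj J v dj \<alpha>
         else set_dj (reset G J (down G J v)) v dj \<alpha>)"

text \<open>A sequence \<open>Js 0, Js 1, \<dots>\<close> of \<open>N\<close> steps, where \<open>N = \<infinity>\<close> for an infinite sequence. A finite
  sequence may stop at \<open>Js k\<close> only if \<open>Js k\<close> has no unjustified node or if it is stuck, that is,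
  no operation is executable; that it never gets stuck is not presupposed.\<close>

definition justify_sequence ::
    "'v parity_game \<Rightarrow> 'v justification \<Rightarrow> enat \<Rightarrow> (nat \<Rightarrow> 'v justification) \<Rightarrow> bool" where
  "justify_sequence G J0 N Js \<longleftrightarrow>
     Js 0 = J0 \<and>
     (\<forall>i. enat i < N \<longrightarrow>
        (\<exists>v dj. executable G (Js i) v dj \<and> Js (Suc i) = Justify G (Js i) v dj)) \<and>
     (\<forall>k. N = enat k \<and> unjustified G (Js k) \<noteq> {} \<longrightarrow> (\<nexists>v dj. executable G (Js k) v dj))"

lemma safe_initial:
  assumes "parity_game G"
  shows "safe G \<lparr>edges = {}, hyp = default_hyp G\<rparr>"
  by (auto simp: safe_def winning_def weakly_winning_def is_justification_def justified_def
      out_edges_def infinite_path_def jl_def default_hyp_def unjustified_def intro: INF_greatest)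

end

theory Submission
  imports Defs
begin

text \<open>
  A step that flips the hypothesis of \<open>v\<close> first resets all nodes that reach
  \<open>v\<close>, which is always safe, and then updates \<open>v\<close> in a justification where
  \<open>v\<close> has no incoming edges. An update is safe because the old levels do not decrease along
  the new edges: on a new path that visits \<open>v\<close> infinitely often they never exceed the level
  of \<open>v\<close>. As the level of the new direct justification is strictly larger if
  \<open>v\<close> was justified, \<open>v\<close> was unjustified and has the highest priority on the
  path.

  With \<open>n\<close> nodes, let a justified node whose level exceeds the priorities of exactly
  \<open>r\<close> nodes weigh \<open>(n + 1) ^ r\<close>, and an unjustified node \<open>0\<close>. The
  justified nodes that a step resets have levels below the new level of \<open>v\<close>, so the gain at
  \<open>v\<close> outweighs their loss and every sequence is finite. It does not get stuck: an
  unjustified node of least priority can always be justified. Once no node is unjustified, the plays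
  consistent with the strategy of a player, from the nodes whose hypothesis is that player, are paths of
  the justification.
\<close>

section \<open>Parity games\<close>

lemma play_winner_shift: "play_winner G (\<lambda>i. p (i + k)) = play_winner G p"
proof -
  have "infinite {i. prio G (p (i + k)) = m} \<longleftrightarrow> infinite {i. prio G (p i) = m}" for m
    unfolding frequently_cofinite[symmetric] cofinite_eq_sequentially frequently_def
    using eventually_sequentially_seg[of "\<lambda>i. prio G (p i) \<noteq> m" k] by simp
  then show ?thesis by (simp add: play_winner_def)
qed

lemma play_winner_dominating:
  assumes bound: "\<And>i. prio G (p i) \<le> prio G v" and recurrent: "infinite {i. p i = v}"
  shows "play_winner G p = prio G v mod 2"
proof -
  let ?M = "{m. infinite {i. prio G (p i) = m}}"
  have upper: "m \<le> prio G v" if "m \<in> ?M" for m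
    using bound that not_finite_existsD by fastforce
  have "{i. p i = v} \<subseteq> {i. prio G (p i) = prio G v}" by auto
  then have "prio G v \<in> ?M"
    using recurrent finite_subset by blast
  moreover have "finite ?M"
    by (rule finite_subset[of _ "{..prio G v}"]) (use upper in auto)
  ultimately have "Max ?M = prio G v"
    using upper by (intro Max_eqI)
  then show ?thesis by (simp add: play_winner_def)
qed

locale game =
  fixes G :: "'v parity_game"
  assumes parity_game: "parity_game G"
begin

lemma finite_nodes: "finite (nodes G)"
  using parity_game by (simp add: parity_game_def)

lemma moves_nodes:
  assumes "(u, w) \<in> moves G"
  shows "u \<in> nodes G" "w \<in> nodes G"
  using parity_game assms by (auto simp: parity_game_def)

lemma exists_move: "v \<in> nodes G \<Longrightarrow> \<exists>w. (v, w) \<in> moves G"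
  using parity_game by (simp add: parity_game_def)

lemma owner_player: "v \<in> nodes G \<Longrightarrow> owner G v \<in> {0, 1}"
  using parity_game by (simp add: parity_game_def)

lemma exists_consistent_play:
  assumes "\<rho> \<subseteq> moves G" "v \<in> nodes G"
  shows "\<exists>p. play G p \<and> p 0 = v \<and> consistent \<rho> p"
proof -
  have "\<exists>w. w \<in> nodes G \<and> (u, w) \<in> moves G \<and> (u \<in> Domain \<rho> \<longrightarrow> (u, w) \<in> \<rho>)"
    if "u \<in> nodes G" for u
    using assms(1) exists_move[OF that] moves_nodes by (cases "u \<in> Domain \<rho>") blast+
  then have "\<exists>p. \<forall>i. (p i \<in> nodes G \<and> (i = 0 \<longrightarrow> p i = v)) \<and>
      (p i, p (Suc i)) \<in> moves G \<and> (p i \<in> Domain \<rho> \<longrightarrow> (p i, p (Suc i)) \<in> \<rho>)"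
    using assms(2) by (intro dependent_nat_choice) auto
  then show ?thesis
    unfolding play_def infinite_path_def consistent_def by blast
qed

lemma wins_unique:
  assumes "v \<in> nodes G" "wins G \<alpha> v" "wins G \<beta> v"
  shows "\<alpha> = \<beta>"
proof (rule ccontr)
  assume "\<alpha> \<noteq> \<beta>"
  obtain \<sigma> \<tau> where \<sigma>: "strategy G \<alpha> \<sigma>" "wins_from G \<alpha> \<sigma> v"
    and \<tau>: "strategy G \<beta> \<tau>" "wins_from G \<beta> \<tau> v"
    using assms(2,3) by (auto simp: wins_def)
  have "\<sigma> \<union> \<tau> \<subseteq> moves G"
    using \<sigma>(1) \<tau>(1) by (simp add: strategy_def)
  then obtain p where p: "play G p" "p 0 = v" "consistent (\<sigma> \<union> \<tau>) p"
    using exists_consistent_play assms(1) by blast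
  have "Domain \<sigma> \<inter> Domain \<tau> = {}"
    using \<sigma>(1) \<tau>(1) \<open>\<alpha> \<noteq> \<beta>\<close> by (force simp: strategy_def)
  then have "consistent \<sigma> p" "consistent \<tau> p"
    using p(3) by (auto simp: consistent_def)
  then show False
    using p(1,2) \<sigma>(2) \<tau>(2) \<open>\<alpha> \<noteq> \<beta>\<close> by (auto simp: wins_from_def)
qed

end

section \<open>Justifications\<close>

lemma unjustified_eq: "unjustified G J = nodes G - justified G J"
  by (auto simp: unjustified_def justified_def)

lemma winning_djD:
  assumes "winning_dj G H \<alpha> v dj"
  shows "v \<in> nodes G" "\<alpha> \<in> {0, 1}" "dj \<subseteq> moves G" "\<And>e. e \<in> dj \<Longrightarrow> fst e = v"
    "\<And>u w. (u, w) \<in> dj \<Longrightarrow> H w = \<alpha>"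
  using assms by (auto simp: winning_dj_def direct_justification_def split: if_splits)

lemma winning_dj_cong:
  assumes "winning_dj G H \<alpha> v dj" "\<And>u w. (u, w) \<in> dj \<Longrightarrow> H' w = H w"
  shows "winning_dj G H' \<alpha> v dj"
  using assms by (fastforce simp: winning_dj_def)

lemma (in game) winning_dj_nonempty: "winning_dj G H \<alpha> v dj \<Longrightarrow> dj \<noteq> {}"
  using exists_move by (fastforce simp: winning_dj_def direct_justification_def split: if_splits)

lemma winning_imp_weakly_winning: "winning G J \<Longrightarrow> weakly_winning G J"
  by (simp add: winning_def)

lemma weakly_winningD:
  assumes "weakly_winning G J"
  shows "edges J \<subseteq> moves G" "\<And>v. v \<in> nodes G \<Longrightarrow> hyp J v \<in> {0, 1}"
    "\<And>v. v \<in> justified G J \<Longrightarrow> winning_dj G (hyp J) (hyp J v) v (out_edges J v)"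
  using assms by (simp_all add: weakly_winning_def is_justification_def)

context game
begin

lemma weakly_winning_edge_justified:
  assumes "weakly_winning G J" "(u, w) \<in> edges J"
  shows "u \<in> justified G J"
  using weakly_winningD(1)[OF assms(1)] assms(2) moves_nodes
  by (auto simp: justified_def out_edges_def)

lemma weakly_winning_hyp_edge:
  assumes "weakly_winning G J" "(u, w) \<in> edges J"
  shows "hyp J w = hyp J u"
  using winning_djD(5)[OF weakly_winningD(3)[OF assms(1) weakly_winning_edge_justified[OF assms]],
      of u w] assms(2)
  by (simp add: out_edges_def)

lemma weakly_winning_hyp_rtrancl:
  assumes "weakly_winning G J" "(u, w) \<in> (edges J)\<^sup>*"
  shows "hyp J w = hyp J u"
  using assms(2) by induction (simp_all add: weakly_winning_hyp_edge[OF assms(1)])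

lemma weakly_winning_hyp_path:
  assumes "weakly_winning G J" "infinite_path (edges J) p"
  shows "hyp J (p i) = hyp J (p 0)"
proof -
  have "hyp J (p (Suc i)) = hyp J (p i)" for i
    using assms by (intro weakly_winning_hyp_edge) (simp_all add: infinite_path_def)
  then show ?thesis by (induction i) simp_all
qed

end

lemma safe_imp_winning: "safe G J \<Longrightarrow> winning G J"
  by (simp add: safe_def)

lemma safe_imp_weakly_winning: "safe G J \<Longrightarrow> weakly_winning G J"
  by (simp add: safe_imp_winning winning_imp_weakly_winning)

lemma safe_hyp_unjustified: "\<lbrakk>safe G J; v \<in> unjustified G J\<rbrakk> \<Longrightarrow> hyp J v = default_hyp G v"
  by (simp add: safe_def)

lemma safe_prio_le_jl: "\<lbrakk>safe G J; v \<in> nodes G\<rbrakk> \<Longrightarrow> enat (prio G v) \<le> jl G J v"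
  by (simp add: safe_def)

section \<open>Justification levels\<close>

lemma jl_le_prio:
  "\<lbrakk>x \<in> unjustified G J; (u, x) \<in> (edges J)\<^sup>*\<rbrakk> \<Longrightarrow> jl G J u \<le> enat (prio G x)"
  by (auto simp: jl_def intro: INF_lower)

lemma jl_mono_edge: "(u, w) \<in> edges J \<Longrightarrow> jl G J u \<le> jl G J w"
  unfolding jl_def by (rule INF_superset_mono) (auto intro: converse_rtrancl_into_rtrancl)

lemma jl_mono_rtrancl: "(u, w) \<in> (edges J)\<^sup>* \<Longrightarrow> jl G J u \<le> jl G J w"
  by (induction rule: rtrancl_induct) (auto dest: jl_mono_edge order_trans)

lemma jl_greatest:
  assumes prio: "\<And>x. x \<in> unjustified G J \<Longrightarrow> f x \<le> enat (prio G x)"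
    and edge: "\<And>u w. (u, w) \<in> edges J \<Longrightarrow> f u \<le> f w"
  shows "f u \<le> jl G J u"
  unfolding jl_def
proof (rule INF_greatest, clarify)
  fix x assume "x \<in> unjustified G J" "(u, x) \<in> (edges J)\<^sup>*"
  from this(2) have "f u \<le> f x"
    by (induction rule: converse_rtrancl_induct) (auto dest: edge order_trans)
  also have "\<dots> \<le> enat (prio G x)" by (rule prio) fact
  finally show "f u \<le> enat (prio G x)" .
qed

lemma jl_unjustified:
  assumes "v \<in> unjustified G J"
  shows "jl G J v = enat (prio G v)"
proof -
  have "w = v" if "(v, w) \<in> (edges J)\<^sup>*" for w
    using that assms
    by (cases rule: converse_rtranclE) (auto simp: unjustified_def out_edges_def)
  then have "{w \<in> unjustified G J. (v, w) \<in> (edges J)\<^sup>*} = {v}"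
    using assms by auto
  then show ?thesis by (simp add: jl_def)
qed

lemma enat_INF_attained:
  fixes f :: "'a \<Rightarrow> enat"
  assumes "A \<noteq> {}"
  obtains a where "a \<in> A" "(INF x\<in>A. f x) = f a"
proof -
  from assms obtain a where "f a \<in> f ` A" by blast
  then have "(INF x\<in>A. f x) \<in> f ` A" by (rule wellorder_InfI)
  then show thesis using that by blast
qed

lemma jl_attained:
  assumes "jl G J u \<noteq> \<infinity>"
  obtains x where "x \<in> unjustified G J" "(u, x) \<in> (edges J)\<^sup>*" "jl G J u = enat (prio G x)"
proof -
  have "{w \<in> unjustified G J. (u, w) \<in> (edges J)\<^sup>*} \<noteq> {}"
    using assms unfolding jl_def by (metis INF_empty top_enat_def)
  then obtain x where "x \<in> {w \<in> unjustified G J. (u, w) \<in> (edges J)\<^sup>*}"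
    "(INF w\<in>{w \<in> unjustified G J. (u, w) \<in> (edges J)\<^sup>*}. enat (prio G w)) = enat (prio G x)"
    by (rule enat_INF_attained)
  then show thesis using that by (auto simp: jl_def)
qed

lemma jl_dj_le: "(v, w) \<in> dj \<Longrightarrow> jl_dj G J dj \<le> jl G J w"
  unfolding jl_dj_def by (force intro: INF_lower2)

lemma le_jl_djI: "(\<And>v w. (v, w) \<in> dj \<Longrightarrow> l \<le> jl G J w) \<Longrightarrow> l \<le> jl_dj G J dj"
  by (auto simp: jl_dj_def intro: INF_greatest)

lemma jl_dj_mono:
  assumes "\<And>v w. (v, w) \<in> dj \<Longrightarrow> jl G J w \<le> jl G J' w"
  shows "jl_dj G J dj \<le> jl_dj G J' dj"
  using assms by (intro le_jl_djI) (blast intro: jl_dj_le order_trans)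

lemma jl_dj_out_edges_le_jl:
  assumes "v \<in> justified G J"
  shows "jl_dj G J (out_edges J v) \<le> jl G J v"
  unfolding jl_def
proof (rule INF_greatest, clarify)
  fix x assume x: "x \<in> unjustified G J" "(v, x) \<in> (edges J)\<^sup>*"
  then have "x \<noteq> v" using assms by (auto simp: unjustified_eq)
  then obtain w where w: "(v, w) \<in> edges J" "(w, x) \<in> (edges J)\<^sup>*"
    using x(2) by (auto elim: converse_rtranclE)
  have "jl_dj G J (out_edges J v) \<le> jl G J w"
    using w(1) by (intro jl_dj_le) (simp add: out_edges_def)
  also have "\<dots> \<le> enat (prio G x)" using x(1) w(2) by (rule jl_le_prio)
  finally show "jl_dj G J (out_edges J v) \<le> enat (prio G x)" .
qed

lemma (in game) safe_hyp_jl: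
  assumes "safe G J" "jl G J u = enat m"
  shows "hyp J u = m mod 2"
proof -
  obtain x where x: "x \<in> unjustified G J" "(u, x) \<in> (edges J)\<^sup>*" "prio G x = m"
    using jl_attained[of G J u] assms(2) by auto
  have "hyp J u = hyp J x"
    using weakly_winning_hyp_rtrancl[OF safe_imp_weakly_winning[OF assms(1)] x(2)] by simp
  also have "\<dots> = m mod 2"
    using safe_hyp_unjustified[OF assms(1) x(1)] x(3) by (simp add: default_hyp_def)
  finally show ?thesis .
qed

section \<open>Resetting nodes\<close>

lemma out_edges_reset: "out_edges (reset G J S) u = (if u \<in> S then {} else out_edges J u)"
  by (auto simp: out_edges_def reset_def)

lemma justified_reset: "justified G (reset G J S) = justified G J - S"
  by (auto simp: justified_def out_edges_reset)

lemma unjustified_reset: "unjustified G (reset G J S) = unjustified G J \<union> (nodes G \<inter> S)"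
  by (auto simp: unjustified_eq justified_reset)

lemma hyp_reset: "hyp (reset G J S) u = (if u \<in> S then default_hyp G u else hyp J u)"
  by (simp add: reset_def)

lemma edges_reset: "edges (reset G J S) = {e \<in> edges J. fst e \<notin> S}"
  by (simp add: reset_def)

lemma weakly_winning_reset:
  assumes ww: "weakly_winning G J" and closed: "(edges J)\<inverse> `` S \<subseteq> S"
  shows "weakly_winning G (reset G J S)"
proof -
  have "is_justification G (reset G J S)"
    using weakly_winningD(1,2)[OF ww]
    by (auto simp: is_justification_def edges_reset hyp_reset default_hyp_def)
  moreover have "winning_dj G (hyp (reset G J S)) (hyp J u) u (out_edges J u)"
    if u: "u \<in> justified G J" "u \<notin> S" for u
  proof (rule winning_dj_cong[OF weakly_winningD(3)[OF ww u(1)]])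
    fix a w assume "(a, w) \<in> out_edges J u"
    then have "w \<notin> S" using u(2) closed by (auto simp: out_edges_def)
    then show "hyp (reset G J S) w = hyp J w" by (simp add: hyp_reset)
  qed
  ultimately show ?thesis
    by (simp add: weakly_winning_def justified_reset out_edges_reset hyp_reset)
qed

lemma winning_reset:
  assumes win: "winning G J" and closed: "(edges J)\<inverse> `` S \<subseteq> S"
  shows "winning G (reset G J S)"
proof -
  have "play_winner G p = hyp (reset G J S) (p 0)" if "infinite_path (edges (reset G J S)) p" for p
  proof -
    have "infinite_path (edges J) p" "p 0 \<notin> S"
      using that by (auto simp: infinite_path_def edges_reset)
    then show ?thesis using win by (simp add: winning_def hyp_reset)
  qed
  then show ?thesis
    using weakly_winning_reset[OF winning_imp_weakly_winning[OF win] closed]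
    by (simp add: winning_def)
qed

lemma jl_reset_ge:
  assumes closed: "(edges J)\<inverse> `` S \<subseteq> S"
  shows "(if u \<in> S then enat (prio G u) else jl G J u) \<le> jl G (reset G J S) u"
proof (rule jl_greatest[where f = "\<lambda>u. if u \<in> S then enat (prio G u) else jl G J u"])
  fix x assume "x \<in> unjustified G (reset G J S)"
  then show "(if x \<in> S then enat (prio G x) else jl G J x) \<le> enat (prio G x)"
    by (auto simp: unjustified_reset jl_unjustified)
next
  fix u w assume "(u, w) \<in> edges (reset G J S)"
  then have "(u, w) \<in> edges J" "u \<notin> S" "w \<notin> S"
    using closed by (auto simp: edges_reset)
  then show "(if u \<in> S then enat (prio G u) else jl G J u) \<le>
      (if w \<in> S then enat (prio G w) else jl G J w)"
    by (simp add: jl_mono_edge)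
qed

lemma safe_reset:
  assumes safe: "safe G J" and closed: "(edges J)\<inverse> `` S \<subseteq> S"
  shows "safe G (reset G J S)"
proof -
  have "enat (prio G u) \<le> jl G (reset G J S) u" if "u \<in> nodes G" for u
    using order_trans[OF _ jl_reset_ge[OF closed]] safe_prio_le_jl[OF safe that]
    by (cases "u \<in> S") auto
  then show ?thesis
    using winning_reset[OF safe_imp_winning[OF safe] closed] safe_hyp_unjustified[OF safe]
    by (auto simp: safe_def unjustified_reset hyp_reset)
qed

lemma (in game) down_closed:
  assumes "weakly_winning G J"
  shows "(edges J)\<inverse> `` down G J v \<subseteq> down G J v"
  using weakly_winningD(1)[OF assms] moves_nodes
  by (auto simp: down_def intro: converse_rtrancl_into_rtrancl)

section \<open>Updating a node\<close>

locale justification_update = game G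
  for G :: "'v parity_game" +
  fixes J :: "'v justification" and v :: 'v and dj :: "('v \<times> 'v) set" and \<alpha> :: nat
  assumes executable: "executable G J v dj"
    and winning_dj: "winning_dj G (hyp J) \<alpha> v dj"
    and hyp_incoming: "v \<in> Range (edges J) \<Longrightarrow> hyp J v = \<alpha>"
begin

abbreviation "J' \<equiv> set_dj J v dj \<alpha>"

lemma safe: "safe G J"
  using executable by (simp add: executable_def)

lemma jl_le_jl_dj: "jl G J v \<le> jl_dj G J dj"
  using executable winning_djD(1)[OF winning_dj]
  by (auto simp: executable_def unjustified_eq intro: less_imp_le)

lemma edges_update: "edges J' = {e \<in> edges J. fst e \<noteq> v} \<union> dj"
  by (simp add: set_dj_def)

lemma out_edges_update: "out_edges J' u = (if u = v then dj else out_edges J u)"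
  using winning_djD(4)[OF winning_dj] by (auto simp: out_edges_def edges_update)

lemma justified_update: "justified G J' = insert v (justified G J)"
  using winning_dj_nonempty[OF winning_dj] winning_djD(1)[OF winning_dj]
  by (auto simp: justified_def out_edges_update)

lemma hyp_update: "hyp J' u = (if u = v then \<alpha> else hyp J u)"
  by (simp add: set_dj_def)

lemma hyp_update_eq:
  assumes "v \<in> Range (edges J')"
  shows "hyp J' = hyp J"
proof -
  have "hyp J v = \<alpha>"
    using assms hyp_incoming winning_djD(5)[OF winning_dj] by (auto simp: edges_update)
  then show ?thesis by (simp add: hyp_update fun_eq_iff)
qed

lemma hyp_update_target:
  assumes "(u, w) \<in> edges J'"
  shows "hyp J' w = hyp J w"
proof (cases "w = v")
  case True
  then have "v \<in> Range (edges J')" using assms by blast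
  then show ?thesis by (simp add: hyp_update_eq)
qed (simp add: hyp_update)

lemma weakly_winning_update: "weakly_winning G J'"
proof -
  note ww = safe_imp_weakly_winning[OF safe]
  have "is_justification G J'"
    using weakly_winningD(1,2)[OF ww] winning_djD(2,3)[OF winning_dj]
    by (auto simp: is_justification_def edges_update hyp_update)
  moreover have "winning_dj G (hyp J') (hyp J' u) u (out_edges J' u)"
    if "u \<in> justified G J'" for u
  proof (rule winning_dj_cong)
    show "winning_dj G (hyp J) (hyp J' u) u (out_edges J' u)"
      using that winning_dj weakly_winningD(3)[OF ww]
      by (auto simp: justified_update out_edges_update hyp_update)
  next
    fix a w assume "(a, w) \<in> out_edges J' u"
    then show "hyp J' w = hyp J w"
      by (auto simp: out_edges_def dest: hyp_update_target)
  qed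
  ultimately show ?thesis by (simp add: weakly_winning_def)
qed

lemma jl_mono_update_edge:
  assumes "(u, w) \<in> edges J'"
  shows "jl G J u \<le> jl G J w"
proof (cases "(u, w) \<in> dj")
  case True
  then have "u = v" using winning_djD(4)[OF winning_dj] by fastforce
  then have "jl G J u \<le> jl_dj G J dj" using jl_le_jl_dj by simp
  also have "\<dots> \<le> jl G J w" using True by (rule jl_dj_le)
  finally show ?thesis .
next
  case False
  then show ?thesis using assms by (auto simp: edges_update intro: jl_mono_edge)
qed

lemma jl_le_jl_update: "jl G J u \<le> jl G J' u"
proof (rule jl_greatest)
  show "jl G J x \<le> enat (prio G x)" if "x \<in> unjustified G J'" for x
    using that by (simp add: unjustified_eq justified_update jl_unjustified)
qed (rule jl_mono_update_edge)

lemma jl_dj_le_jl_update: "jl_dj G J dj \<le> jl G J' v"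
proof -
  have "jl_dj G J dj \<le> jl_dj G J' dj"
    by (intro jl_dj_mono jl_le_jl_update)
  also have "\<dots> \<le> jl G J' v"
    using jl_dj_out_edges_le_jl[of v G J'] by (simp add: justified_update out_edges_update)
  finally show ?thesis .
qed

lemma play_winner_update_transient:
  assumes p: "infinite_path (edges J') p" and transient: "finite {i. p i = v}"
  shows "play_winner G p = hyp J' (p 0)"
proof -
  obtain k where k: "\<And>i. p i = v \<Longrightarrow> i < k"
    using transient by (auto simp: finite_nat_set_iff_bounded)
  have avoids: "p (i + k) \<noteq> v" for i
    using k[of "i + k"] by auto
  have "infinite_path (edges J) (\<lambda>i. p (i + k))"
    unfolding infinite_path_def
  proof
    fix i
    have "(p (i + k), p (Suc i + k)) \<in> edges J'"
      using p by (simp add: infinite_path_def)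
    then show "(p (i + k), p (Suc i + k)) \<in> edges J"
      using avoids[of i] by (auto simp: edges_update dest: winning_djD(4)[OF winning_dj])
  qed
  then have "play_winner G (\<lambda>i. p (i + k)) = hyp J (p k)"
    using safe_imp_winning[OF safe] by (simp add: winning_def)
  then have "play_winner G p = hyp J' (p k)"
    using avoids[of 0] by (simp add: play_winner_shift hyp_update)
  then show ?thesis
    using weakly_winning_hyp_path[OF weakly_winning_update p, of k] by simp
qed

lemma jl_recurrent_path_le:
  assumes p: "infinite_path (edges J') p" and recurrent: "infinite {i. p i = v}"
  shows "jl G J (p i) \<le> jl G J v"
proof -
  obtain j where "i \<le> j" "p j = v"
    using recurrent by (auto simp: infinite_nat_iff_unbounded_le)
  moreover have "jl G J (p i) \<le> jl G J (p (Suc i))" for i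
    using p by (intro jl_mono_update_edge) (simp add: infinite_path_def)
  ultimately show ?thesis
    using lift_Suc_mono_le[of "\<lambda>i. jl G J (p i)" i j] by simp
qed

lemma recurrent_path_imp_unjustified:
  assumes p: "infinite_path (edges J') p" and recurrent: "infinite {i. p i = v}"
  shows "v \<in> unjustified G J"
proof -
  obtain i where "p i = v"
    using not_finite_existsD[OF recurrent] by blast
  moreover have "(p i, p (Suc i)) \<in> edges J'"
    using p by (simp add: infinite_path_def)
  ultimately have "(v, p (Suc i)) \<in> dj"
    by (simp add: edges_update)
  then have "jl_dj G J dj \<le> jl G J (p (Suc i))" by (rule jl_dj_le)
  also have "\<dots> \<le> jl G J v" using assms by (rule jl_recurrent_path_le)
  finally show ?thesis
    using executable winning_djD(1)[OF winning_dj] by (auto simp: executable_def unjustified_eq)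
qed

lemma play_winner_update_recurrent:
  assumes p: "infinite_path (edges J') p" and recurrent: "infinite {i. p i = v}"
  shows "play_winner G p = hyp J' (p 0)"
proof -
  have edge: "(p i, p (Suc i)) \<in> edges J'" for i
    using p by (simp add: infinite_path_def)
  have v: "v \<in> unjustified G J"
    using assms by (rule recurrent_path_imp_unjustified)
  have "prio G (p i) \<le> prio G v" for i
  proof -
    have "p i \<in> nodes G"
      using weakly_winningD(1)[OF weakly_winning_update] edge moves_nodes(1) by blast
    then have "enat (prio G (p i)) \<le> jl G J (p i)" by (rule safe_prio_le_jl[OF safe])
    also have "\<dots> \<le> jl G J v" using assms by (rule jl_recurrent_path_le)
    also have "\<dots> = enat (prio G v)" using v by (rule jl_unjustified)
    finally show ?thesis by simp
  qed
  then have "play_winner G p = default_hyp G v"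
    unfolding default_hyp_def using recurrent by (rule play_winner_dominating)
  also have "\<dots> = hyp J v"
    using safe_hyp_unjustified[OF safe v] by simp
  also have "\<dots> = hyp J' (p 0)"
  proof -
    obtain j where "0 < j" "p j = v"
      using recurrent by (auto simp: infinite_nat_iff_unbounded)
    then obtain i where "p (Suc i) = v" using gr0_conv_Suc by auto
    then have "hyp J v = hyp J' (p (Suc i))"
      using hyp_update_target[OF edge[of i]] by simp
    also have "\<dots> = hyp J' (p 0)"
      by (rule weakly_winning_hyp_path[OF weakly_winning_update p])
    finally show ?thesis .
  qed
  finally show ?thesis .
qed

lemma safe_update: "safe G J'"
proof -
  have "winning G J'"
    using weakly_winning_update play_winner_update_transient play_winner_update_recurrent
    by (auto simp: winning_def)
  moreover have "hyp J' u = default_hyp G u" if "u \<in> unjustified G J'" for u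
    using that safe_hyp_unjustified[OF safe, of u]
    by (auto simp: unjustified_eq justified_update hyp_update)
  moreover have "enat (prio G u) \<le> jl G J' u" if "u \<in> nodes G" for u
    using safe_prio_le_jl[OF safe that] jl_le_jl_update by (rule order_trans)
  ultimately show ?thesis by (simp add: safe_def)
qed

end

section \<open>Justify steps\<close>

context game
begin

lemma Justify_eq:
  assumes "winning_dj G (hyp J) \<alpha> v dj"
  shows "Justify G J v dj =
    set_dj (if hyp J v = \<alpha> then J else reset G J (down G J v)) v dj \<alpha>"
proof -
  have "(THE \<alpha>. winning_dj G (hyp J) \<alpha> v dj) = \<alpha>"
    using assms winning_dj_unique[OF parity_game _ assms] by (rule the_equality)
  then show ?thesis by (simp add: Justify_def)
qed

lemma executable_jl_less_jl_dj:
  assumes exec: "executable G J v dj" and dj: "winning_dj G (hyp J) \<alpha> v dj"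
    and "hyp J v \<noteq> \<alpha>"
  shows "jl G J v < jl_dj G J dj"
proof (cases "v \<in> justified G J")
  case True
  then show ?thesis using exec by (simp add: executable_def)
next
  case False
  then have v: "v \<in> unjustified G J"
    using winning_djD(1)[OF dj] by (simp add: unjustified_eq)
  have safe: "safe G J" and "jl G J v \<le> jl_dj G J dj"
    using exec v by (simp_all add: executable_def)
  moreover have "jl G J v \<noteq> jl_dj G J dj"
  proof
    assume "jl G J v = jl_dj G J dj"
    moreover obtain e where "e \<in> dj" "jl_dj G J dj = jl G J (snd e)"
      using winning_dj_nonempty[OF dj] unfolding jl_dj_def by (rule enat_INF_attained)
    ultimately have "jl G J (snd e) = enat (prio G v)" "hyp J (snd e) = \<alpha>"
      using jl_unjustified[OF v] winning_djD(5)[OF dj, of "fst e" "snd e"] by simp_all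
    then have "hyp J v = \<alpha>"
      using safe_hyp_jl[OF safe] jl_unjustified[OF v] by metis
    with \<open>hyp J v \<noteq> \<alpha>\<close> show False by contradiction
  qed
  ultimately show ?thesis by simp
qed

lemma winning_dj_target_not_down:
  assumes "weakly_winning G J" "winning_dj G (hyp J) \<alpha> v dj" "hyp J v \<noteq> \<alpha>" "(u, w) \<in> dj"
  shows "w \<notin> down G J v"
  using weakly_winning_hyp_rtrancl[OF assms(1)] winning_djD(5)[OF assms(2,4)] assms(3)
  by (fastforce simp: down_def)

lemma jl_dj_le_jl_dj_reset_down:
  assumes ww: "weakly_winning G J" and "winning_dj G (hyp J) \<alpha> v dj" "hyp J v \<noteq> \<alpha>"
  shows "jl_dj G J dj \<le> jl_dj G (reset G J (down G J v)) dj"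
proof (rule jl_dj_mono)
  fix u w assume "(u, w) \<in> dj"
  then have "w \<notin> down G J v" using assms by (intro winning_dj_target_not_down)
  then show "jl G J w \<le> jl G (reset G J (down G J v)) w"
    using jl_reset_ge[OF down_closed[OF ww, of v], of w] by simp
qed

lemma justification_update_keep:
  assumes "executable G J v dj" "winning_dj G (hyp J) \<alpha> v dj" "hyp J v = \<alpha>"
  shows "justification_update G J v dj \<alpha>"
  using assms by unfold_locales

lemma justification_update_flip:
  assumes exec: "executable G J v dj" and dj: "winning_dj G (hyp J) \<alpha> v dj"
    and flip: "hyp J v \<noteq> \<alpha>"
  shows "justification_update G (reset G J (down G J v)) v dj \<alpha>"
proof
  let ?S = "down G J v"
  let ?J = "reset G J ?S"
  have safe: "safe G J" using exec by (simp add: executable_def)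
  note ww = safe_imp_weakly_winning[OF safe]
  have v: "v \<in> nodes G" "v \<in> ?S"
    using winning_djD(1)[OF dj] by (simp_all add: down_def)
  show dj': "winning_dj G (hyp ?J) \<alpha> v dj"
    by (rule winning_dj_cong[OF dj])
      (simp add: hyp_reset winning_dj_target_not_down[OF ww dj flip])
  have "jl G ?J v = enat (prio G v)"
    using v by (intro jl_unjustified) (simp add: unjustified_reset)
  also have "\<dots> \<le> jl G J v"
    using safe v(1) by (rule safe_prio_le_jl)
  also have "\<dots> \<le> jl_dj G J dj"
    using executable_jl_less_jl_dj[OF exec dj flip] by simp
  also have "\<dots> \<le> jl_dj G ?J dj"
    by (rule jl_dj_le_jl_dj_reset_down[OF ww dj flip])
  finally show "executable G ?J v dj"
    using safe_reset[OF safe down_closed[OF ww]] dj' winning_djD(2)[OF dj] v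
    unfolding executable_def by (auto simp: justified_reset)
  show "hyp ?J v = \<alpha>" if "v \<in> Range (edges ?J)"
    using that down_closed[OF ww, of v] v(2) by (auto simp: edges_reset)
qed

lemma safe_Justify:
  assumes exec: "executable G J v dj"
  shows "safe G (Justify G J v dj)"
proof -
  obtain \<alpha> where dj: "winning_dj G (hyp J) \<alpha> v dj"
    using exec by (auto simp: executable_def)
  show ?thesis
    by (simp add: Justify_eq[OF dj] justification_update.safe_update
        justification_update_keep[OF exec dj] justification_update_flip[OF exec dj])
qed

end

section \<open>Termination\<close>

definition level_rank :: "'v parity_game \<Rightarrow> enat \<Rightarrow> nat" where
  "level_rank G l = card {u \<in> nodes G. enat (prio G u) < l}"

definition node_weight :: "'v parity_game \<Rightarrow> 'v justification \<Rightarrow> 'v \<Rightarrow> nat" where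
  "node_weight G J u =
     (if u \<in> justified G J then Suc (card (nodes G)) ^ level_rank G (jl G J u) else 0)"

definition justification_weight :: "'v parity_game \<Rightarrow> 'v justification \<Rightarrow> nat" where
  "justification_weight G J = (\<Sum>u\<in>nodes G. node_weight G J u)"

lemma sum_less_sum_dominating:
  fixes f g :: "'a \<Rightarrow> nat"
  assumes A: "finite A" "S \<subseteq> A" "v \<in> S" and "card S < b" "0 < g v"
    and inside: "\<And>u. u \<in> S \<Longrightarrow> b * f u \<le> g v"
    and outside: "\<And>u. u \<in> A - S \<Longrightarrow> f u \<le> g u"
  shows "sum f A < sum g A"
proof -
  have "b * sum f S \<le> card S * g v"
    using sum_bounded_above[of S "\<lambda>u. b * f u" "g v"] inside by (simp add: sum_distrib_left)
  also have "\<dots> < b * g v"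
    using assms(4,5) by simp
  finally have "sum f S < g v" by simp
  also have "\<dots> \<le> sum g S"
    using A finite_subset by (intro member_le_sum) auto
  finally have "sum f S < sum g S" .
  moreover have "sum f (A - S) \<le> sum g (A - S)"
    using outside by (rule sum_mono)
  ultimately show ?thesis
    using sum.subset_diff[OF A(2,1), of f] sum.subset_diff[OF A(2,1), of g] by linarith
qed

context game
begin

lemma level_rank_mono: "l \<le> l' \<Longrightarrow> level_rank G l \<le> level_rank G l'"
  unfolding level_rank_def by (rule card_mono) (auto simp: finite_nodes intro: less_le_trans)

lemma level_rank_le_card: "level_rank G l \<le> card (nodes G)"
  unfolding level_rank_def by (rule card_mono) (auto simp: finite_nodes)

lemma level_rank_jl_less:
  assumes "jl G J u < l"
  shows "level_rank G (jl G J u) < level_rank G l"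
proof -
  have "jl G J u \<noteq> \<infinity>" using assms enat_ord_simps(6) by metis
  then obtain x where x: "x \<in> unjustified G J" "jl G J u = enat (prio G x)"
    by (rule jl_attained)
  let ?below = "\<lambda>l. {w \<in> nodes G. enat (prio G w) < l}"
  have "?below (jl G J u) \<subseteq> ?below l"
    using assms less_trans by blast
  moreover have "x \<in> ?below l - ?below (jl G J u)"
    using x assms by (simp add: unjustified_eq)
  ultimately have "?below (jl G J u) \<subset> ?below l" by blast
  then show ?thesis
    unfolding level_rank_def using finite_nodes by (intro psubset_card_mono) auto
qed

lemma node_weight_mono:
  assumes "u \<in> justified G J \<Longrightarrow> u \<in> justified G J' \<and> jl G J u \<le> jl G J' u"
  shows "node_weight G J u \<le> node_weight G J' u"
proof (cases "u \<in> justified G J")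
  case True
  then have "level_rank G (jl G J u) \<le> level_rank G (jl G J' u)"
    using assms by (simp add: level_rank_mono)
  then have "Suc (card (nodes G)) ^ level_rank G (jl G J u)
      \<le> Suc (card (nodes G)) ^ level_rank G (jl G J' u)"
    by (rule power_increasing) simp
  then show ?thesis using True assms by (simp add: node_weight_def)
qed (simp add: node_weight_def)

lemma justification_weight_less:
  assumes S: "S \<subseteq> nodes G" "v \<in> S" and v: "v \<in> justified G J'"
    and inside: "\<And>u. \<lbrakk>u \<in> S; u \<in> justified G J\<rbrakk> \<Longrightarrow> jl G J u < jl G J' v"
    and outside: "\<And>u. \<lbrakk>u \<notin> S; u \<in> justified G J\<rbrakk> \<Longrightarrow> u \<in> justified G J' \<and> jl G J u \<le> jl G J' u"
  shows "justification_weight G J < justification_weight G J'"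
  unfolding justification_weight_def
proof (rule sum_less_sum_dominating[OF finite_nodes S])
  show "card S < Suc (card (nodes G))"
    using card_mono[OF finite_nodes S(1)] by simp
  show "0 < node_weight G J' v"
    using v by (simp add: node_weight_def)
  show "Suc (card (nodes G)) * node_weight G J u \<le> node_weight G J' v" if "u \<in> S" for u
  proof (cases "u \<in> justified G J")
    case True
    then have "Suc (level_rank G (jl G J u)) \<le> level_rank G (jl G J' v)"
      using inside[OF that] by (intro Suc_leI level_rank_jl_less)
    then have "Suc (card (nodes G)) ^ Suc (level_rank G (jl G J u))
        \<le> Suc (card (nodes G)) ^ level_rank G (jl G J' v)"
      by (rule power_increasing) simp
    then show ?thesis using True v by (simp add: node_weight_def)
  qed (simp add: node_weight_def)
  show "node_weight G J u \<le> node_weight G J' u" if "u \<in> nodes G - S" for u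
    by (rule node_weight_mono) (use that outside in blast)
qed

lemma justification_weight_le:
  "justification_weight G J \<le> card (nodes G) * Suc (card (nodes G)) ^ card (nodes G)"
proof -
  have "node_weight G J u \<le> Suc (card (nodes G)) ^ card (nodes G)" for u
    using power_increasing[OF level_rank_le_card[of "jl G J u"], of "Suc (card (nodes G))"]
    by (simp add: node_weight_def)
  then show ?thesis
    using sum_bounded_above[of "nodes G" "node_weight G J"]
    by (simp add: justification_weight_def)
qed

lemma justification_weight_less_keep:
  assumes exec: "executable G J v dj" and dj: "winning_dj G (hyp J) \<alpha> v dj"
    and "hyp J v = \<alpha>"
  shows "justification_weight G J < justification_weight G (set_dj J v dj \<alpha>)"
proof -
  interpret justification_update G J v dj \<alpha>
    using assms by (rule justification_update_keep)
  show ?thesis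
  proof (rule justification_weight_less[where S = "{v}"])
    show "jl G J u < jl G J' v" if "u \<in> {v}" "u \<in> justified G J" for u
      using that exec jl_dj_le_jl_update by (auto simp: executable_def)
  qed (use winning_djD(1)[OF dj] in \<open>simp_all add: justified_update jl_le_jl_update\<close>)
qed

lemma jl_down_less_jl_flip:
  assumes exec: "executable G J v dj" and dj: "winning_dj G (hyp J) \<alpha> v dj"
    and flip: "hyp J v \<noteq> \<alpha>" and u: "u \<in> down G J v"
  shows "jl G J u < jl G (set_dj (reset G J (down G J v)) v dj \<alpha>) v"
proof -
  interpret justification_update G "reset G J (down G J v)" v dj \<alpha>
    using exec dj flip by (rule justification_update_flip)
  have ww: "weakly_winning G J"
    using exec by (simp add: executable_def safe_imp_weakly_winning)
  have "jl G J u \<le> jl G J v"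
    using u by (simp add: down_def jl_mono_rtrancl)
  also have "\<dots> < jl_dj G J dj"
    using exec dj flip by (rule executable_jl_less_jl_dj)
  also have "\<dots> \<le> jl_dj G (reset G J (down G J v)) dj"
    using ww dj flip by (rule jl_dj_le_jl_dj_reset_down)
  also have "\<dots> \<le> jl G J' v"
    by (rule jl_dj_le_jl_update)
  finally show ?thesis .
qed

lemma justification_weight_less_flip:
  assumes exec: "executable G J v dj" and dj: "winning_dj G (hyp J) \<alpha> v dj"
    and flip: "hyp J v \<noteq> \<alpha>"
  shows "justification_weight G J
    < justification_weight G (set_dj (reset G J (down G J v)) v dj \<alpha>)"
proof -
  let ?S = "down G J v"
  interpret justification_update G "reset G J ?S" v dj \<alpha>
    using assms by (rule justification_update_flip)
  have ww: "weakly_winning G J"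
    using exec by (simp add: executable_def safe_imp_weakly_winning)
  show ?thesis
  proof (rule justification_weight_less[where S = ?S])
    show "?S \<subseteq> nodes G" "v \<in> ?S"
      using winning_djD(1)[OF dj] by (auto simp: down_def)
    show "v \<in> justified G J'" by (simp add: justified_update)
    show "jl G J u < jl G J' v" if "u \<in> ?S" for u
      using assms that by (rule jl_down_less_jl_flip)
    show "u \<in> justified G J' \<and> jl G J u \<le> jl G J' u" if "u \<notin> ?S" "u \<in> justified G J" for u
    proof
      show "u \<in> justified G J'"
        using that by (simp add: justified_update justified_reset)
      have "jl G J u \<le> jl G (reset G J ?S) u"
        using jl_reset_ge[OF down_closed[OF ww, of v], of u] that(1) by simp
      also have "\<dots> \<le> jl G J' u" by (rule jl_le_jl_update)
      finally show "jl G J u \<le> jl G J' u" .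
    qed
  qed
qed

lemma justification_weight_less_Justify:
  assumes exec: "executable G J v dj"
  shows "justification_weight G J < justification_weight G (Justify G J v dj)"
proof -
  obtain \<alpha> where dj: "winning_dj G (hyp J) \<alpha> v dj"
    using exec by (auto simp: executable_def)
  show ?thesis
    using justification_weight_less_keep[OF exec dj] justification_weight_less_flip[OF exec dj]
    by (simp add: Justify_eq[OF dj])
qed

section \<open>Progress\<close>

lemma exists_winning_dj:
  assumes H: "\<And>w. w \<in> nodes G \<Longrightarrow> H w \<in> {0, 1}" and v: "v \<in> nodes G"
  shows "\<exists>\<alpha> dj. winning_dj G H \<alpha> v dj"
proof (cases "\<exists>w. (v, w) \<in> moves G \<and> H w = owner G v")
  case True
  then obtain w where "(v, w) \<in> moves G" "H w = owner G v" by blast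
  then have "winning_dj G H (owner G v) v {(v, w)}"
    using v owner_player[OF v] by (simp add: winning_dj_def direct_justification_def)
  then show ?thesis by blast
next
  case False
  have "H w = 1 - owner G v" if "(v, w) \<in> moves G" for w
    using False that H[OF moves_nodes(2)[OF that]] owner_player[OF v] by auto
  then have "winning_dj G H (1 - owner G v) v {e \<in> moves G. fst e = v}"
    using v owner_player[OF v] by (auto simp: winning_dj_def direct_justification_def)
  then show ?thesis by blast
qed

lemma exists_executable:
  assumes safe: "safe G J" and "unjustified G J \<noteq> {}"
  shows "\<exists>v dj. executable G J v dj"
proof -
  obtain v where v: "v \<in> unjustified G J"
    and least: "\<And>x. x \<in> unjustified G J \<Longrightarrow> prio G v \<le> prio G x"
    using assms(2) ex_has_least_nat[of "\<lambda>x. x \<in> unjustified G J" _ "prio G"] by blast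
  obtain \<alpha> dj where dj: "winning_dj G (hyp J) \<alpha> v dj"
    using exists_winning_dj[of "hyp J" v] weakly_winningD(2)[OF safe_imp_weakly_winning[OF safe]] v
    unfolding unjustified_eq by blast
  have "enat (prio G v) \<le> jl G J w" for w
    using least by (intro jl_greatest) simp_all
  then have "jl G J v \<le> jl_dj G J dj"
    by (simp add: jl_unjustified[OF v] le_jl_djI)
  then have "executable G J v dj"
    using safe dj winning_djD(2)[OF dj] v by (auto simp: executable_def unjustified_eq)
  then show ?thesis by blast
qed

section \<open>Justifications without unjustified nodes\<close>

lemma strategy_justification_strategy:
  assumes ww: "weakly_winning G J"
  shows "strategy G \<alpha> (justification_strategy G J \<alpha>)"
proof -
  have "w = w'" if e: "(v, w) \<in> edges J" "(v, w') \<in> edges J" and "owner G v = hyp J v" for v w w'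
  proof -
    have "winning_dj G (hyp J) (hyp J v) v (out_edges J v)"
      using weakly_winningD(3)[OF ww] weakly_winning_edge_justified[OF ww e(1)] .
    then obtain x where "out_edges J v = {(v, x)}"
      using \<open>owner G v = hyp J v\<close> by (auto simp: winning_dj_def direct_justification_def)
    moreover have "(v, w) \<in> out_edges J v" "(v, w') \<in> out_edges J v"
      using e by (simp_all add: out_edges_def)
    ultimately show ?thesis by simp
  qed
  then show ?thesis
    using weakly_winningD(1)[OF ww] moves_nodes(1)
    by (auto simp: strategy_def justification_strategy_def single_valued_def)
qed

lemma justified_consistent_move_in_edges:
  assumes ww: "weakly_winning G J" and v: "v \<in> justified G J" and "(v, w) \<in> moves G"
    and consistent: "v \<in> Domain (justification_strategy G J (hyp J v)) \<Longrightarrow>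
      (v, w) \<in> justification_strategy G J (hyp J v)"
  shows "(v, w) \<in> edges J"
proof (cases "owner G v = hyp J v")
  case True
  then have "v \<in> Domain (justification_strategy G J (hyp J v))"
    using v by (auto simp: justified_def out_edges_def justification_strategy_def)
  then show ?thesis using consistent by (auto simp: justification_strategy_def)
next
  case False
  then have "out_edges J v = {e \<in> moves G. fst e = v}"
    using weakly_winningD(3)[OF ww v] by (simp add: winning_dj_def direct_justification_def)
  then have "(v, w) \<in> out_edges J v" using assms(3) by simp
  then show ?thesis by (simp add: out_edges_def)
qed

lemma wins_from_justification_strategy:
  assumes win: "winning G J" and total: "unjustified G J = {}"
  shows "wins_from G (hyp J v) (justification_strategy G J (hyp J v)) v"
  unfolding wins_from_def
proof (intro allI impI, elim conjE)
  fix p assume p: "play G p" "p 0 = v" "consistent (justification_strategy G J (hyp J v)) p"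
  note ww = winning_imp_weakly_winning[OF win]
  have edge: "(p i, p (Suc i)) \<in> edges J" if "hyp J (p i) = hyp J v" for i
  proof (rule justified_consistent_move_in_edges[OF ww])
    show move: "(p i, p (Suc i)) \<in> moves G"
      using p(1) by (simp add: play_def infinite_path_def)
    show "p i \<in> justified G J"
      using moves_nodes(1)[OF move] total by (auto simp: unjustified_eq)
  qed (use p(3) that in \<open>simp add: consistent_def\<close>)
  have "hyp J (p i) = hyp J v" for i
    by (induction i) (simp_all add: p(2) weakly_winning_hyp_edge[OF ww edge])
  then have "infinite_path (edges J) p"
    using edge by (simp add: infinite_path_def)
  then show "play_winner G p = hyp J v"
    using win p(2) by (simp add: winning_def)
qed

lemma wins_iff_hyp:
  assumes win: "winning G J" and total: "unjustified G J = {}" and v: "v \<in> nodes G"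
  shows "wins G \<alpha> v \<longleftrightarrow> hyp J v = \<alpha>"
proof -
  have "wins G (hyp J v) v"
    unfolding wins_def
    using strategy_justification_strategy[OF winning_imp_weakly_winning[OF win]]
      wins_from_justification_strategy[OF win total] by blast
  then show ?thesis using wins_unique[OF v] by blast
qed

lemma winning_function_hyp:
  assumes "winning G J" "unjustified G J = {}"
  shows "winning_function G (hyp J)"
  using wins_iff_hyp[OF assms] weakly_winningD(2)[OF winning_imp_weakly_winning[OF assms(1)]]
  by (simp add: winning_function_def)

lemma winning_strategy_justification_strategy:
  assumes "winning G J" "unjustified G J = {}"
  shows "winning_strategy G \<alpha> (justification_strategy G J \<alpha>)"
  using strategy_justification_strategy[OF winning_imp_weakly_winning[OF assms(1)]]
    wins_from_justification_strategy[OF assms] wins_iff_hyp[OF assms]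
  by (auto simp: winning_strategy_def)

end

section \<open>Justification sequences\<close>

lemma justify_sequence_step:
  assumes "justify_sequence G J0 N Js" "enat i < N"
  obtains v dj where "executable G (Js i) v dj" "Js (Suc i) = Justify G (Js i) v dj"
  using assms by (auto simp: justify_sequence_def)

context game
begin

lemma safe_justify_sequence:
  assumes "safe G J0" "justify_sequence G J0 N Js" "enat i \<le> N"
  shows "safe G (Js i)"
proof (cases i)
  case 0
  then show ?thesis using assms(1,2) by (simp add: justify_sequence_def)
next
  case (Suc j)
  then show ?thesis
    using assms(2,3) safe_Justify by (metis Suc_ile_eq justify_sequence_step)
qed

lemma justification_weight_justify_sequence:
  assumes "justify_sequence G J0 N Js" "enat i \<le> N"
  shows "i \<le> justification_weight G (Js i)"
  using assms(2)
proof (induction i)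
  case (Suc i)
  then have "enat i < N" by (simp add: Suc_ile_eq)
  with assms(1) obtain v dj where "executable G (Js i) v dj" "Js (Suc i) = Justify G (Js i) v dj"
    by (rule justify_sequence_step)
  then show ?case
    using Suc.IH[OF less_imp_le[OF \<open>enat i < N\<close>]] justification_weight_less_Justify[of "Js i" v dj]
    by simp
qed simp

lemma justify_sequence_length_le:
  assumes "justify_sequence G J0 N Js"
  shows "N \<le> enat (card (nodes G) * Suc (card (nodes G)) ^ card (nodes G))"
proof (rule ccontr)
  let ?b = "card (nodes G) * Suc (card (nodes G)) ^ card (nodes G)"
  assume "\<not> N \<le> enat ?b"
  then have "enat (Suc ?b) \<le> N" by (simp add: Suc_ile_eq)
  then have "Suc ?b \<le> justification_weight G (Js (Suc ?b))"
    by (rule justification_weight_justify_sequence[OF assms])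
  then show False using justification_weight_le[of "Js (Suc ?b)"] by simp
qed

lemma unjustified_justify_sequence_end:
  assumes "safe G (Js k)" "justify_sequence G J0 (enat k) Js"
  shows "unjustified G (Js k) = {}"
  using exists_executable[OF assms(1)] assms(2) by (auto simp: justify_sequence_def)

end

theorem theorem2:
  fixes G :: "'v parity_game"
    and J0 :: "'v justification"
    and N :: enat
    and Js :: "nat \<Rightarrow> 'v justification"
  assumes "parity_game G"
    and "safe G J0"
    and "justify_sequence G J0 N Js"
  shows "\<exists>k. N = enat k \<and>
           safe G (Js k) \<and>
           unjustified G (Js k) = {} \<and>
           winning_function G (hyp (Js k)) \<and>
           winning_strategy G 0 (justification_strategy G (Js k) 0) \<and>
           winning_strategy G 1 (justification_strategy G (Js k) 1)"
proof -
  interpret game G by unfold_locales fact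
  obtain k where k: "N = enat k"
    using justify_sequence_length_le[OF assms(3)] enat_ile by blast
  have safe: "safe G (Js k)"
    using safe_justify_sequence[OF assms(2,3)] k by simp
  have total: "unjustified G (Js k) = {}"
    using unjustified_justify_sequence_end[of Js k J0, OF safe] assms(3) k by simp
  show ?thesis
    using k safe total winning_function_hyp[OF safe_imp_winning[OF safe] total]
      winning_strategy_justification_strategy[OF safe_imp_winning[OF safe] total] by blast
qed

end
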